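(* Let $\mathcal{M}$ be a pointed model and let $k \geq 0$. Then the rooted $k$-contraction of $\mathcal{M}$ is a world minimal model $k$-bisimilar to $\mathcal{M}$, i.e., it is $k$-bisimilar to $\mathcal{M}$ and it has the least number of worlds among all pointed models $k$-bisimilar to $\mathcal{M}$.
   Context: Fix a countable set $\mathcal{P}$ of atomic propositions and a finite set $\mathcal{I}$ of modality indices. A model is $M=(W,R,V)$ with $W$ finite nonempty, $R_i\subseteq W\times W$ for $i\in\mathcal{I}$, $V:\mathcal{P}\to2^W$; a pointed model is $(M,w_d)$ with $w_d\in W$. For $k\ge0$, a $k$-bisimulation between $(M,w_d)$ and $(M',w'_d)$ is a sequence of nonempty relations $Z_k\subseteq\cdots\subseteq Z_0\subseteq W\times W'$ with $(w_d,w'_d)\in Z_k$ such that pairs in $Z_0$ agree on all atoms, and for all $h<k$: if $(w,w')\in Z_{h+1}$ and $wR_iv$ then some $v'$ has $w'R'_iv'$, $(v,v')\in Z_h$ (forth), and symmetrically (back); $k$-bisimilar means such a sequence exists. For worlds of one model, $w\sim_hv$ means $(M,w),(M,v)$ are $h$-bisimilar; $[w]_h=\{v\in W\mid w\sim_hv\}$. With respect to $\mathcal{M}=(M,w_d)$ and $k$: depth $d(w)$ = length of a shortest path from $w_d$ to $w$ along edges of any $R_i$ ($\infty$ if none); bound $b(w)=k-d(w)$. For $x,y$ with nonnegative bound, $x\succ y$ iff $b(x)>b(y)$ and $x\sim_{b(y)}y$. $\mathrm{Max}(W)=\{x\in W\mid b(x)\ge0$ and no $y\in W$ has $y\succ x\}$.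 The rooted $k$-contraction of $\mathcal{M}$ is $((W',R',V'),[w_d]_{b(w_d)})$ with $W'=\{[x]_{b(x)}\mid x\in\mathrm{Max}(W)\}$, $R'_i=\{([x]_{b(x)},[y]_{b(y)})\mid x,y\in\mathrm{Max}(W),\ \exists z\,(xR_iz\text{ and }y\sim_{b(x)-1}z),\ b(x)>0\}$, $V'(p)=\{[x]_{b(x)}\mid x\in\mathrm{Max}(W),\ x\in V(p)\}$. *)

theory Defs
  imports
    "HOL-Library.Countable_Set"
    "HOL-Library.Extended_Nat"
    "HOL-Library.Extended"
begin

text \<open>
  The set \<open>P\<close> of atomic propositions and the set \<open>I\<close> of modality indices are explicit
  carrier sets (so both may be empty).  The values of \<open>rel M\<close> outside \<open>I\<close> and of \<open>val M\<close>
  outside \<open>P\<close> carry no meaning and are never inspected.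
\<close>

record ('w, 'i, 'p) kmodel =
  worlds :: "'w set"
  rel :: "'i \<Rightarrow> ('w \<times> 'w) set"
  val :: "'p \<Rightarrow> 'w set"

type_synonym ('w, 'i, 'p) pmodel = "('w, 'i, 'p) kmodel \<times> 'w"

definition is_model :: "'p set \<Rightarrow> 'i set \<Rightarrow> ('w, 'i, 'p) kmodel \<Rightarrow> bool" where
  "is_model P I M \<longleftrightarrow>
     finite (worlds M) \<and> worlds M \<noteq> {} \<and>
     (\<forall>i\<in>I. rel M i \<subseteq> worlds M \<times> worlds M) \<and>
     (\<forall>p\<in>P. val M p \<subseteq> worlds M)"

definition is_pmodel :: "'p set \<Rightarrow> 'i set \<Rightarrow> ('w, 'i, 'p) pmodel \<Rightarrow> bool" where
  "is_pmodel P I A \<longleftrightarrow> is_model P I (fst A) \<and> snd A \<in> worlds (fst A)"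

text \<open>Only the members \<open>Z 0, \<dots>, Z k\<close> of the sequence \<open>Z\<close> are constrained.\<close>

definition is_bisimulation ::
  "'p set \<Rightarrow> 'i set \<Rightarrow> nat \<Rightarrow> ('w, 'i, 'p) pmodel \<Rightarrow> ('v, 'i, 'p) pmodel \<Rightarrow>
   (nat \<Rightarrow> ('w \<times> 'v) set) \<Rightarrow> bool" where
  "is_bisimulation P I k A B Z \<longleftrightarrow>
     (let M = fst A; M' = fst B in
       (\<forall>h\<le>k. Z h \<noteq> {}) \<and>
       (\<forall>h<k. Z (Suc h) \<subseteq> Z h) \<and>
       Z 0 \<subseteq> worlds M \<times> worlds M' \<and>
       (snd A, snd B) \<in> Z k \<and>
       (\<forall>(w, w')\<in>Z 0. \<forall>p\<in>P. w \<in> val M p \<longleftrightarrow> w' \<in> val M' p) \<and>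
       (\<forall>h<k. \<forall>(w, w')\<in>Z (Suc h). \<forall>i\<in>I. \<forall>v.
          (w, v) \<in> rel M i \<longrightarrow> (\<exists>v'. (w', v') \<in> rel M' i \<and> (v, v') \<in> Z h)) \<and>
       (\<forall>h<k. \<forall>(w, w')\<in>Z (Suc h). \<forall>i\<in>I. \<forall>v'.
          (w', v') \<in> rel M' i \<longrightarrow> (\<exists>v. (w, v) \<in> rel M i \<and> (v, v') \<in> Z h)))"

definition bisimilar ::
  "'p set \<Rightarrow> 'i set \<Rightarrow> nat \<Rightarrow> ('w, 'i, 'p) pmodel \<Rightarrow> ('v, 'i, 'p) pmodel \<Rightarrow> bool" where
  "bisimilar P I k A B \<longleftrightarrow> (\<exists>Z. is_bisimulation P I k A B Z)"

definition world_bisim ::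
  "'p set \<Rightarrow> 'i set \<Rightarrow> ('w, 'i, 'p) kmodel \<Rightarrow> nat \<Rightarrow> 'w \<Rightarrow> 'w \<Rightarrow> bool" where
  "world_bisim P I M h w v \<longleftrightarrow> bisimilar P I h (M, w) (M, v)"

definition bisim_class ::
  "'p set \<Rightarrow> 'i set \<Rightarrow> ('w, 'i, 'p) kmodel \<Rightarrow> nat \<Rightarrow> 'w \<Rightarrow> 'w set" where
  "bisim_class P I M h w = {v \<in> worlds M. world_bisim P I M h w v}"

text \<open>The infimum of the empty set of extended naturals is \<open>\<infinity>\<close> (unreachable worlds).\<close>

definition depth :: "'i set \<Rightarrow> ('w, 'i, 'p) pmodel \<Rightarrow> 'w \<Rightarrow> enat" where
  "depth I A w = Inf {enat n | n. (snd A, w) \<in> (\<Union>i\<in>I. rel (fst A) i) ^^ n}"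

definition bound :: "'i set \<Rightarrow> ('w, 'i, 'p) pmodel \<Rightarrow> nat \<Rightarrow> 'w \<Rightarrow> int extended" where
  "bound I A k w = (case depth I A w of enat n \<Rightarrow> Fin (int k - int n) | \<infinity> \<Rightarrow> Minf)"

text \<open>
  A nonnegative bound read as a natural number, so that it can index bisimilarity.  The value
  for a negative bound is junk and is not used below.
\<close>

definition level :: "'i set \<Rightarrow> ('w, 'i, 'p) pmodel \<Rightarrow> nat \<Rightarrow> 'w \<Rightarrow> nat" where
  "level I A k w = (case bound I A k w of Fin z \<Rightarrow> nat z | _ \<Rightarrow> 0)"

definition dominates ::
  "'p set \<Rightarrow> 'i set \<Rightarrow> ('w, 'i, 'p) pmodel \<Rightarrow> nat \<Rightarrow> 'w \<Rightarrow> 'w \<Rightarrow> bool" where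
  "dominates P I A k x y \<longleftrightarrow>
     bound I A k x \<ge> 0 \<and> bound I A k y \<ge> 0 \<and>
     bound I A k x > bound I A k y \<and>
     world_bisim P I (fst A) (level I A k y) x y"

definition max_worlds :: "'p set \<Rightarrow> 'i set \<Rightarrow> ('w, 'i, 'p) pmodel \<Rightarrow> nat \<Rightarrow> 'w set" where
  "max_worlds P I A k =
     {x \<in> worlds (fst A). bound I A k x \<ge> 0 \<and>
        \<not> (\<exists>y\<in>worlds (fst A). dominates P I A k y x)}"

definition level_class ::
  "'p set \<Rightarrow> 'i set \<Rightarrow> ('w, 'i, 'p) pmodel \<Rightarrow> nat \<Rightarrow> 'w \<Rightarrow> 'w set" where
  "level_class P I A k x = bisim_class P I (fst A) (level I A k x) x"

text \<open>In \<open>rel\<close> below, truncated subtraction is harmless, as the bound of \<open>x\<close> is positive.\<close>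

definition rooted_contraction ::
  "'p set \<Rightarrow> 'i set \<Rightarrow> nat \<Rightarrow> ('w, 'i, 'p) pmodel \<Rightarrow> ('w set, 'i, 'p) pmodel" where
  "rooted_contraction P I k A =
     (\<lparr> worlds = {level_class P I A k x | x. x \<in> max_worlds P I A k},
        rel = (\<lambda>i. {(level_class P I A k x, level_class P I A k y) | x y.
                x \<in> max_worlds P I A k \<and> y \<in> max_worlds P I A k \<and>
                (\<exists>z. (x, z) \<in> rel (fst A) i \<and>
                     world_bisim P I (fst A) (level I A k x - 1) y z) \<and>
                bound I A k x > 0}),
        val = (\<lambda>p. {level_class P I A k x | x.
                x \<in> max_worlds P I A k \<and> x \<in> val (fst A) p}) \<rparr>,
      level_class P I A k (snd A))"

end

theory Submission
  imports Defs
begin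

text \<open>
  Two maximal worlds \<open>x\<close>, \<open>y\<close> that are bisimilar up to the smaller of their bounds have equal
  bounds, since otherwise one would dominate the other; hence they have the same class.  As every
  world of nonnegative bound lies below a maximal one, the relations
  \<open>Z\<^sub>h = {([x], w) | x \<in> Max(W), h \<le> b(x), x \<sim>\<^sub>h w}\<close> form a \<open>k\<close>-bisimulation.  For minimality,
  following a shortest path from the root shows that every maximal \<open>x\<close> is \<open>b(x)\<close>-bisimilar to some
  world of a given \<open>k\<close>-bisimilar model, and no such world can serve two different classes.
\<close>

section \<open>Bounded bisimilarity as a recursive relation\<close>

text \<open>The largest \<open>k\<close>-bisimulation, obtained by recursion on the depth instead of
  quantifying over sequences \<open>Z\<close>. The conjunct at depth \<open>h\<close> in the second
  clause makes the relations decreasing by construction.\<close>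

primrec kbis :: "'p set \<Rightarrow> 'i set \<Rightarrow> ('w, 'i, 'p) kmodel \<Rightarrow> ('v, 'i, 'p) kmodel \<Rightarrow> nat \<Rightarrow>
    'w \<Rightarrow> 'v \<Rightarrow> bool" where
  "kbis P I M N 0 w v \<longleftrightarrow> w \<in> worlds M \<and> v \<in> worlds N \<and> (\<forall>p\<in>P. w \<in> val M p \<longleftrightarrow> v \<in> val N p)"
| "kbis P I M N (Suc h) w v \<longleftrightarrow> kbis P I M N h w v \<and>
    (\<forall>i\<in>I. \<forall>w'. (w, w') \<in> rel M i \<longrightarrow> (\<exists>v'. (v, v') \<in> rel N i \<and> kbis P I M N h w' v')) \<and>
    (\<forall>i\<in>I. \<forall>v'. (v, v') \<in> rel N i \<longrightarrow> (\<exists>w'. (w, w') \<in> rel M i \<and> kbis P I M N h w' v'))"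

lemma kbis_mono: "kbis P I M N h w v \<Longrightarrow> g \<le> h \<Longrightarrow> kbis P I M N g w v"
  by (induction h) (auto simp: le_Suc_eq)

lemma kbis_worlds:
  assumes "kbis P I M N h w v"
  shows "w \<in> worlds M" "v \<in> worlds N"
  using kbis_mono[OF assms, of 0] by auto

lemma kbis_forth:
  assumes "kbis P I M N (Suc h) w v" "i \<in> I" "(w, w') \<in> rel M i"
  obtains v' where "(v, v') \<in> rel N i" "kbis P I M N h w' v'"
  using assms unfolding kbis.simps by meson

lemma kbis_back:
  assumes "kbis P I M N (Suc h) w v" "i \<in> I" "(v, v') \<in> rel N i"
  obtains w' where "(w, w') \<in> rel M i" "kbis P I M N h w' v'"
  using assms unfolding kbis.simps by meson

lemma kbis_refl:
  "is_model P I M \<Longrightarrow> w \<in> worlds M \<Longrightarrow> kbis P I M M h w w"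
proof (induction h arbitrary: w)
  case (Suc h)
  have "w' \<in> worlds M" if "i \<in> I" "(w, w') \<in> rel M i" for i w'
    using Suc.prems that unfolding is_model_def by blast
  with Suc show ?case by auto
qed auto

lemma kbis_sym: "kbis P I M N h w v \<Longrightarrow> kbis P I N M h v w"
proof (induction h arbitrary: w v)
  case (Suc h)
  then show ?case unfolding kbis.simps by meson
qed auto

lemma kbis_trans:
  "kbis P I M N h w v \<Longrightarrow> kbis P I N L h v u \<Longrightarrow> kbis P I M L h w u"
proof (induction h arbitrary: w v u)
  case (Suc h)
  show ?case
    unfolding kbis.simps
  proof (intro conjI ballI allI impI)
    show "kbis P I M L h w u"
      using Suc by auto
    fix i assume i: "i \<in> I"
    show "\<exists>u'. (u, u') \<in> rel L i \<and> kbis P I M L h w' u'" if "(w, w') \<in> rel M i" for w'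
      by (meson Suc i that kbis_forth)
    show "\<exists>w'. (w, w') \<in> rel M i \<and> kbis P I M L h w' u'" if "(u, u') \<in> rel L i" for u'
      by (meson Suc i that kbis_back)
  qed
qed auto

lemma is_bisimulation_imp_kbis:
  assumes "is_bisimulation P I k (M, r) (N, s) Z" "h \<le> k" "(w, v) \<in> Z h"
  shows "kbis P I M N h w v"
  using assms(2,3)
proof (induction h arbitrary: w v)
  case 0
  then show ?case
    using assms(1) unfolding is_bisimulation_def Let_def by auto
next
  case (Suc h)
  then have "h < k" by simp
  with assms(1) have Z: "Z (Suc h) \<subseteq> Z h"
    "\<And>w v i w'. (w, v) \<in> Z (Suc h) \<Longrightarrow> i \<in> I \<Longrightarrow> (w, w') \<in> rel M i \<Longrightarrow>
       \<exists>v'. (v, v') \<in> rel N i \<and> (w', v') \<in> Z h"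
    "\<And>w v i v'. (w, v) \<in> Z (Suc h) \<Longrightarrow> i \<in> I \<Longrightarrow> (v, v') \<in> rel N i \<Longrightarrow>
       \<exists>w'. (w, w') \<in> rel M i \<and> (w', v') \<in> Z h"
    unfolding is_bisimulation_def Let_def by (simp, fastforce+)
  have IH: "kbis P I M N h w v" if "(w, v) \<in> Z h" for w v
    using Suc.IH[OF _ that] \<open>h < k\<close> by simp
  show ?case
    using Z(1) Z(2)[OF Suc.prems(2)] Z(3)[OF Suc.prems(2)] IH Suc.prems(2)
    unfolding kbis.simps by blast
qed

text \<open>Every bisimulation is contained in the \<open>kbis\<close> relations levelwise.
  Conversely these form one themselves: by monotonicity \<open>(r, s)\<close> lies in each of them,
  so none is empty.\<close>

lemma bisimilar_iff_kbis:
  "bisimilar P I k (M, r) (N, s) \<longleftrightarrow> kbis P I M N k r s"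
proof
  assume "bisimilar P I k (M, r) (N, s)"
  then obtain Z where Z: "is_bisimulation P I k (M, r) (N, s) Z"
    unfolding bisimilar_def by blast
  then have "(r, s) \<in> Z k"
    by (simp add: is_bisimulation_def Let_def)
  with Z show "kbis P I M N k r s"
    using is_bisimulation_imp_kbis[OF Z] by simp
next
  assume r: "kbis P I M N k r s"
  have "is_bisimulation P I k (M, r) (N, s) (\<lambda>h. {(w, v). kbis P I M N h w v})"
    using r kbis_mono[OF r] unfolding is_bisimulation_def Let_def by auto
  then show "bisimilar P I k (M, r) (N, s)"
    unfolding bisimilar_def by blast
qed

lemma world_bisim_iff_kbis: "world_bisim P I M h w v \<longleftrightarrow> kbis P I M M h w v"
  by (simp add: world_bisim_def bisimilar_iff_kbis)

text \<open>Each edge of the path uses up one level by the forth condition. For a shortest path the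
  remaining level \<open>k - n\<close> is the bound of \<open>x\<close>.\<close>

lemma kbis_relpow:
  assumes "kbis P I M N k r s" "(r, x) \<in> (\<Union>i\<in>I. rel M i) ^^ n" "n \<le> k"
  obtains v where "kbis P I M N (k - n) x v"
  using assms(2,3)
proof (induction n arbitrary: x thesis)
  case 0
  then show ?case using assms(1) by auto
next
  case (Suc n)
  from Suc.prems(2) obtain y i where y: "(r, y) \<in> (\<Union>i\<in>I. rel M i) ^^ n" "i \<in> I" "(y, x) \<in> rel M i"
    by auto
  from Suc.IH[OF _ y(1)] Suc.prems(3) obtain v where "kbis P I M N (k - n) y v"
    by auto
  moreover have "k - n = Suc (k - Suc n)"
    using Suc.prems(3) by simp
  ultimately show ?case
    using kbis_forth y(2,3) Suc.prems(1) by metis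
qed

section \<open>Depth, bound and level\<close>

text \<open>The infimum of the empty set is infinite, so a finite depth is the least element of a
  nonempty set and is attained by a path.\<close>

lemma depth_eq_enatD:
  assumes "depth I A w = enat n"
  shows "(snd A, w) \<in> (\<Union>i\<in>I. rel (fst A) i) ^^ n"
proof -
  let ?D = "{enat n | n. (snd A, w) \<in> (\<Union>i\<in>I. rel (fst A) i) ^^ n}"
  have Inf: "Inf ?D = enat n"
    using assms by (simp add: depth_def)
  then have "?D \<noteq> {}"
    unfolding Inf_enat_def by (metis enat.distinct(1))
  then have "Inf ?D \<in> ?D"
    unfolding Inf_enat_def using LeastI_ex[of "\<lambda>x. x \<in> ?D"] by auto
  with Inf show ?thesis
    by auto
qed

lemma depth_le:
  "(snd A, w) \<in> (\<Union>i\<in>I. rel (fst A) i) ^^ n \<Longrightarrow> depth I A w \<le> enat n"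
  unfolding depth_def by (rule Inf_lower) blast

text \<open>Allows nonnegative bounds to be compared as natural numbers.\<close>

lemma bound_eq_level: "0 \<le> bound I A k x \<Longrightarrow> bound I A k x = Fin (int (level I A k x))"
  by (auto simp: level_def bound_def zero_extended_def split: enat.splits)

lemma bound_nonnegD:
  assumes "0 \<le> bound I A k x"
  shows "depth I A x = enat (k - level I A k x)" "level I A k x \<le> k"
  using assms by (auto simp: level_def bound_def zero_extended_def split: enat.splits)

lemma bound_nonneg_if_relpow:
  assumes "(snd A, x) \<in> (\<Union>i\<in>I. rel (fst A) i) ^^ n" "n \<le> k"
  shows "0 \<le> bound I A k x" "k - n \<le> level I A k x"
  using depth_le[OF assms(1)] assms(2)
  by (cases "depth I A x"; simp add: level_def bound_def zero_extended_def)+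

lemma bound_pos_iff: "0 < bound I A k x \<longleftrightarrow> 0 \<le> bound I A k x \<and> 0 < level I A k x"
  by (auto simp: level_def bound_def zero_extended_def split: enat.splits)

lemma bound_root: "0 \<le> bound I A k (snd A)" "level I A k (snd A) = k"
proof -
  have root: "(snd A, snd A) \<in> (\<Union>i\<in>I. rel (fst A) i) ^^ 0"
    by simp
  show "0 \<le> bound I A k (snd A)" "level I A k (snd A) = k"
    using bound_nonneg_if_relpow[OF root, of k] bound_nonnegD(2)[of I A k "snd A"] by simp_all
qed

text \<open>A shortest path to \<open>x\<close> extended by the edge reaches \<open>z\<close>. Only
  an inequality results, since \<open>z\<close> may have a shorter path.\<close>

lemma bound_successor:
  assumes "0 \<le> bound I A k x" "0 < level I A k x" "i \<in> I" "(x, z) \<in> rel (fst A) i"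
  shows "0 \<le> bound I A k z" "level I A k x - 1 \<le> level I A k z"
proof -
  let ?n = "Suc (k - level I A k x)"
  have "(snd A, z) \<in> (\<Union>i\<in>I. rel (fst A) i) ^^ ?n"
    using depth_eq_enatD[OF bound_nonnegD(1)[OF assms(1)]] assms(3,4) by auto
  moreover have "?n \<le> k" "k - ?n = level I A k x - 1"
    using bound_nonnegD(2)[OF assms(1)] assms(2) by auto
  ultimately show "0 \<le> bound I A k z" "level I A k x - 1 \<le> level I A k z"
    using bound_nonneg_if_relpow by metis+
qed

section \<open>Domination and maximal worlds\<close>

lemma dominates_iff:
  "dominates P I A k x y \<longleftrightarrow> 0 \<le> bound I A k x \<and> 0 \<le> bound I A k y \<and>
     level I A k y < level I A k x \<and> kbis P I (fst A) (fst A) (level I A k y) x y"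
  using bound_eq_level[of I A k x] bound_eq_level[of I A k y]
  by (auto simp: dominates_def world_bisim_iff_kbis)

lemma max_worldsD:
  assumes "x \<in> max_worlds P I A k"
  shows "x \<in> worlds (fst A)" "0 \<le> bound I A k x"
  using assms by (auto simp: max_worlds_def)

text \<open>Otherwise \<open>y\<close> would dominate \<open>x\<close>. Later arguments use the
  maximality of \<open>x\<close> in this form.\<close>

lemma max_worlds_level_le:
  assumes "x \<in> max_worlds P I A k" "0 \<le> bound I A k y"
    and "kbis P I (fst A) (fst A) (level I A k x) y x"
  shows "level I A k y \<le> level I A k x"
  using assms kbis_worlds(1)[OF assms(3)] by (force simp: max_worlds_def dominates_iff)

text \<open>The root has bound \<open>k\<close>, which no world exceeds.\<close>

lemma root_in_max_worlds:
  assumes "is_pmodel P I A"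
  shows "snd A \<in> max_worlds P I A k"
  using assms bound_root[of I A k] bound_nonnegD(2)[of I A k]
  by (auto simp: max_worlds_def dominates_iff is_pmodel_def leD)

text \<open>Levels are at most \<open>k\<close>, so some candidate in \<open>?S\<close> has the
  greatest level. A world dominating it would again be in \<open>?S\<close>, by transitivity at the
  lower level of \<open>z\<close>, and would have a greater level.\<close>

lemma obtain_max_world:
  assumes "is_pmodel P I A" "z \<in> worlds (fst A)" "0 \<le> bound I A k z"
  obtains y where "y \<in> max_worlds P I A k" "level I A k z \<le> level I A k y"
    "kbis P I (fst A) (fst A) (level I A k z) y z"
proof -
  let ?M = "fst A" and ?l = "level I A k"
  let ?S = "{y. 0 \<le> bound I A k y \<and> ?l z \<le> ?l y \<and> kbis P I ?M ?M (?l z) y z}"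
  have "z \<in> ?S"
    using assms by (simp add: is_pmodel_def kbis_refl)
  moreover have "?l y \<le> k" if "y \<in> ?S" for y
    using that bound_nonnegD(2)[of I A k y] by simp
  ultimately have "\<exists>y. y \<in> ?S \<and> (\<forall>y'. y' \<in> ?S \<longrightarrow> ?l y' \<le> ?l y)"
    by (intro ex_has_greatest_nat[of _ z _ "Suc k"]) (simp_all add: less_Suc_eq_le)
  then obtain y where y: "y \<in> ?S" "\<And>y'. y' \<in> ?S \<Longrightarrow> ?l y' \<le> ?l y"
    by (elim exE conjE) simp
  have "\<not> dominates P I A k y' y" for y'
  proof
    assume y': "dominates P I A k y' y"
    then have "kbis P I ?M ?M (?l z) y' y"
      using y(1) kbis_mono[of P I ?M ?M "?l y" y' y "?l z"] by (simp add: dominates_iff)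
    with y(1) have "kbis P I ?M ?M (?l z) y' z"
      using kbis_trans[of P I ?M ?M "?l z" y' y ?M z] by simp
    with y(1) y' have "y' \<in> ?S"
      unfolding dominates_iff by simp
    with y(2) y' show False
      unfolding dominates_iff by (meson leD)
  qed
  moreover have "y \<in> worlds ?M"
    using y(1) kbis_worlds(1)[of P I ?M ?M "?l z" y z] by simp
  ultimately have "y \<in> max_worlds P I A k"
    using y(1) by (simp add: max_worlds_def)
  with y(1) show ?thesis
    using that[of y] by simp
qed

section \<open>Classes of maximal worlds\<close>

text \<open>Maximality of each world bounds the level of the other, so both classes are taken at the
  same level.\<close>

lemma level_class_eq_if_kbis:
  assumes "x \<in> max_worlds P I A k" "y \<in> max_worlds P I A k"
    and "kbis P I (fst A) (fst A) (level I A k x) y x" "kbis P I (fst A) (fst A) (level I A k y) x y"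
  shows "level_class P I A k x = level_class P I A k y"
proof -
  have "level I A k x = level I A k y"
    using assms max_worldsD(2) max_worlds_level_le by (metis order_antisym)
  then show ?thesis
    using assms(3,4) unfolding level_class_def bisim_class_def world_bisim_iff_kbis
    by (auto intro: kbis_trans)
qed

text \<open>Each class contains its representative, so equal classes give bisimilarity at both
  levels, and maximality equates these. This makes the choice of representative in the contraction
  harmless.\<close>

lemma level_class_eqD:
  assumes "is_pmodel P I A" "x \<in> max_worlds P I A k" "y \<in> max_worlds P I A k"
    and "level_class P I A k x = level_class P I A k y"
  shows "level I A k x = level I A k y" "kbis P I (fst A) (fst A) (level I A k x) x y"
proof -
  have "z \<in> level_class P I A k z" if "z \<in> max_worlds P I A k" for z
    using assms(1) max_worldsD(1)[OF that] kbis_refl[of P I "fst A" z]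
    by (auto simp: level_class_def bisim_class_def world_bisim_iff_kbis is_pmodel_def)
  with assms(2-4) have "x \<in> level_class P I A k y" "y \<in> level_class P I A k x"
    by auto
  then have bis: "kbis P I (fst A) (fst A) (level I A k y) y x"
    "kbis P I (fst A) (fst A) (level I A k x) x y"
    by (auto simp: level_class_def bisim_class_def world_bisim_iff_kbis)
  then show "level I A k x = level I A k y"
    using assms max_worldsD(2) max_worlds_level_le kbis_sym by (metis order_antisym)
  show "kbis P I (fst A) (fst A) (level I A k x) x y"
    by (fact bis)
qed

section \<open>The contraction is a model and is bisimilar to the original\<close>

lemma worlds_rooted_contraction:
  "worlds (fst (rooted_contraction P I k A)) = level_class P I A k ` max_worlds P I A k"
  by (auto simp: rooted_contraction_def)

lemma is_pmodel_rooted_contraction: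
  assumes "is_pmodel P I A"
  shows "is_pmodel P I (rooted_contraction P I k A)"
proof -
  have "finite (max_worlds P I A k)"
    using assms by (simp add: max_worlds_def is_pmodel_def is_model_def)
  then show ?thesis
    using root_in_max_worlds[OF assms, of k]
    by (auto simp: is_pmodel_def is_model_def rooted_contraction_def)
qed

text \<open>Letting \<open>w\<close> be any world bisimilar to \<open>x\<close> up to
  \<open>h\<close> absorbs the passage from a successor to a maximal world standing for it. The
  bound \<open>h \<le> level I A k x\<close> is needed as the class of \<open>x\<close> records its
  behaviour only up to that level.\<close>

lemma kbis_rooted_contraction:
  assumes A: "is_pmodel P I A"
    and "x \<in> max_worlds P I A k" "h \<le> level I A k x" "kbis P I (fst A) (fst A) h x w"
  shows "kbis P I (fst (rooted_contraction P I k A)) (fst A) h (level_class P I A k x) w"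
  using assms(2-4)
proof (induction h arbitrary: x w)
  case 0
  have "level_class P I A k x \<in> val (fst (rooted_contraction P I k A)) p \<longleftrightarrow> x \<in> val (fst A) p"
    if "p \<in> P" for p
  proof -
    have "y \<in> val (fst A) p \<longleftrightarrow> x \<in> val (fst A) p"
      if "y \<in> max_worlds P I A k" "level_class P I A k x = level_class P I A k y" for y
      using kbis_mono[OF level_class_eqD(2)[OF A 0(1) that], of 0] \<open>p \<in> P\<close> by simp
    moreover have "val (fst (rooted_contraction P I k A)) p =
        level_class P I A k ` {y \<in> max_worlds P I A k. y \<in> val (fst A) p}"
      by (auto simp: rooted_contraction_def)
    ultimately show ?thesis
      using 0(1) by blast
  qed
  then show ?case
    using 0 by (auto simp: worlds_rooted_contraction)
next
  case (Suc h)
  let ?M = "fst A" and ?C = "fst (rooted_contraction P I k A)"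
  let ?l = "level I A k" and ?cl = "level_class P I A k"
  show ?case
    unfolding kbis.simps(2)
  proof (intro conjI ballI allI impI)
    show "kbis P I ?C ?M h (?cl x) w"
      using Suc by simp
  next
    fix i c assume i: "i \<in> I" and "(?cl x, c) \<in> rel ?C i"
    \<comment> \<open>The edge may come from another representative \<open>x'\<close> of the class,
      with the same level as \<open>x\<close>.\<close>
    then obtain x' y z where *: "x' \<in> max_worlds P I A k" "?cl x = ?cl x'"
      "y \<in> max_worlds P I A k" "c = ?cl y" "(x', z) \<in> rel ?M i" "kbis P I ?M ?M (?l x' - 1) y z"
      by (auto simp: rooted_contraction_def world_bisim_iff_kbis)
    have x': "?l x' = ?l x" "kbis P I ?M ?M (?l x) x x'"
      using level_class_eqD[OF A Suc.prems(1) *(1,2)] by auto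
    then have h: "h \<le> ?l x' - 1" "0 < ?l x'"
      using Suc.prems(2) by auto
    have z: "0 \<le> bound I A k z" "?l x' - 1 \<le> ?l z"
      using bound_successor[OF max_worldsD(2)[OF *(1)] h(2) i *(5)] by auto
    \<comment> \<open>Were \<open>y\<close> lower, \<open>z\<close> would have a greater level than
      \<open>y\<close> while being bisimilar to it up to \<open>?l y\<close>, against the maximality
      of \<open>y\<close>.\<close>
    have "?l x' - 1 \<le> ?l y"
    proof (rule ccontr)
      assume "\<not> ?l x' - 1 \<le> ?l y"
      moreover from this have "kbis P I ?M ?M (?l y) z y"
        by (intro kbis_mono[OF kbis_sym[OF *(6)]]) simp
      ultimately show False
        using max_worlds_level_le[OF *(3) z(1)] z(2) by simp
    qed
    with h have "h \<le> ?l y" by simp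
    have "kbis P I ?M ?M (Suc h) x' w"
      using x' Suc.prems(2,3) by (meson kbis_mono kbis_sym kbis_trans)
    then obtain v where v: "(w, v) \<in> rel ?M i" "kbis P I ?M ?M h z v"
      using i *(5) by (rule kbis_forth)
    have "kbis P I ?M ?M h y v"
      using kbis_trans[OF kbis_mono[OF *(6) h(1)] v(2)] .
    then show "\<exists>v. (w, v) \<in> rel ?M i \<and> kbis P I ?C ?M h c v"
      using Suc.IH[OF *(3) \<open>h \<le> ?l y\<close>] v(1) *(4) by blast
  next
    fix i v assume i: "i \<in> I" and "(w, v) \<in> rel ?M i"
    then obtain z where z: "(x, z) \<in> rel ?M i" "kbis P I ?M ?M h z v"
      using Suc.prems(3) kbis_back by metis
    have x: "0 \<le> bound I A k x" "0 < ?l x"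
      using Suc.prems(2) max_worldsD(2)[OF Suc.prems(1)] by simp_all
    note z' = bound_successor[OF x i z(1)]
    \<comment> \<open>The successor \<open>z\<close> need not be maximal, so its class is replaced
      by that of a maximal \<open>y\<close>. They agree up to \<open>?l z\<close>, hence up to the
      level \<open>?l x - 1\<close> that an edge of the contraction demands.\<close>
    obtain y where y: "y \<in> max_worlds P I A k" "?l z \<le> ?l y" "kbis P I ?M ?M (?l z) y z"
      using obtain_max_world[OF A kbis_worlds(1)[OF z(2)] z'(1)] .
    have "(?cl x, ?cl y) \<in> rel ?C i"
      using Suc.prems(1) y(1) z(1) x kbis_mono[OF y(3) z'(2)]
      by (auto simp: rooted_contraction_def world_bisim_iff_kbis bound_pos_iff)
    moreover have "h \<le> ?l z"
      using Suc.prems(2) z'(2) by simp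
    then have "kbis P I ?C ?M h (?cl y) v"
      using Suc.IH[OF y(1)] y(2) kbis_trans[OF kbis_mono[OF y(3)] z(2)] by simp
    ultimately show "\<exists>c. (?cl x, c) \<in> rel ?C i \<and> kbis P I ?C ?M h c v"
      by blast
  qed
qed

lemma bisimilar_rooted_contraction:
  assumes "is_pmodel P I A"
  shows "bisimilar P I k (rooted_contraction P I k A) A"
proof -
  have "kbis P I (fst A) (fst A) k (snd A) (snd A)"
    using assms by (simp add: is_pmodel_def kbis_refl)
  then have "kbis P I (fst (rooted_contraction P I k A)) (fst A) k (level_class P I A k (snd A)) (snd A)"
    using kbis_rooted_contraction[OF assms root_in_max_worlds[OF assms]] bound_root(2)[of I A k]
    by simp
  then show ?thesis
    using bisimilar_iff_kbis[of P I k "fst (rooted_contraction P I k A)"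
        "snd (rooted_contraction P I k A)" "fst A" "snd A"]
    by (simp add: rooted_contraction_def)
qed

section \<open>Minimality\<close>

lemma card_rooted_contraction_le:
  fixes A :: "('w, 'i, 'p) pmodel" and B :: "('v, 'i, 'p) pmodel"
  assumes "is_pmodel P I B" "bisimilar P I k B A"
  shows "card (worlds (fst (rooted_contraction P I k A))) \<le> card (worlds (fst B))"
proof -
  have root: "kbis P I (fst A) (fst B) k (snd A) (snd B)"
    using assms(2) bisimilar_iff_kbis[of P I k "fst B" "snd B" "fst A" "snd A"] kbis_sym by auto
  \<comment> \<open>The shortest path to \<open>x\<close> has length
    \<open>k - level I A k x\<close>, so the level left over is exactly that of
    \<open>x\<close>.\<close>
  have "\<exists>v. kbis P I (fst A) (fst B) (level I A k x) x v" if "x \<in> max_worlds P I A k" for x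
    using kbis_relpow[OF root depth_eq_enatD[OF bound_nonnegD(1)]] max_worldsD(2)[OF that]
      bound_nonnegD(2)[of I A k x]
    by (metis diff_diff_cancel diff_le_self)
  then obtain f where f: "kbis P I (fst A) (fst B) (level I A k x) x (f x)"
    if "x \<in> max_worlds P I A k" for x
    by metis
  \<comment> \<open>Bisimilarity is composed through the shared partner \<open>f x = f y\<close> at
    the smaller of the two levels.\<close>
  have bis: "kbis P I (fst A) (fst A) (level I A k x) y x"
    if "x \<in> max_worlds P I A k" "y \<in> max_worlds P I A k" "f x = f y"
      "level I A k x \<le> level I A k y" for x y
    using that f by (metis kbis_mono kbis_sym kbis_trans)
  have eq: "level_class P I A k x = level_class P I A k y"
    if x: "x \<in> max_worlds P I A k" and y: "y \<in> max_worlds P I A k" and "f x = f y"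
      "level I A k x \<le> level I A k y" for x y
  proof -
    have "level I A k y \<le> level I A k x"
      using max_worlds_level_le[OF x max_worldsD(2)[OF y] bis[OF that]] .
    then show ?thesis
      using level_class_eq_if_kbis[OF x y] bis that by metis
  qed
  have inj: "level_class P I A k x = level_class P I A k y"
    if "x \<in> max_worlds P I A k" "y \<in> max_worlds P I A k" "f x = f y" for x y
    using eq that by (metis nat_le_linear)
  \<comment> \<open>Distinct worlds of one class may have distinct partners, so the count goes
    through a map from \<open>B\<close> onto the classes. Its values outside the range of
    \<open>f\<close> do not matter for surjectivity.\<close>
  let ?g = "\<lambda>v. level_class P I A k (inv_into (max_worlds P I A k) f v)"
  have "level_class P I A k x \<in> ?g ` worlds (fst B)" if x: "x \<in> max_worlds P I A k" for x
  proof (rule image_eqI)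
    have fx: "f x \<in> f ` max_worlds P I A k"
      using x by (rule imageI)
    show "level_class P I A k x = ?g (f x)"
      by (rule inj[OF x inv_into_into[OF fx] f_inv_into_f[OF fx, symmetric]])
    show "f x \<in> worlds (fst B)"
      by (rule kbis_worlds(2)[OF f[OF x]])
  qed
  moreover have "finite (worlds (fst B))"
    using assms(1) by (simp add: is_pmodel_def is_model_def)
  ultimately have "card (level_class P I A k ` max_worlds P I A k) \<le> card (worlds (fst B))"
    by (intro surj_card_le[of _ _ ?g] image_subsetI)
  then show ?thesis
    by (simp add: worlds_rooted_contraction)
qed

theorem theorem4p4:
  fixes P :: "'p set" and I :: "'i set"
    and A :: "('w, 'i, 'p) pmodel" and k :: nat
  assumes "countable P" and "finite I" and "is_pmodel P I A"
  shows "is_pmodel P I (rooted_contraction P I k A) \<and>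
    bisimilar P I k (rooted_contraction P I k A) A \<and>
    (\<forall>B :: ('v, 'i, 'p) pmodel.
       is_pmodel P I B \<longrightarrow> bisimilar P I k B A \<longrightarrow>
       card (worlds (fst (rooted_contraction P I k A))) \<le> card (worlds (fst B)))"
  using is_pmodel_rooted_contraction[OF assms(3)] bisimilar_rooted_contraction[OF assms(3)]
    card_rooted_contraction_le by blast

end
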